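(* Let $K=\mathbb{F}_q$ be a finite field, let $v_1,\ldots,v_n$ be positive integers, and let $X\subset\mathbb{P}^{n-1}$ be the degenerate projective torus parameterized by $x_1^{v_1},\ldots,x_n^{v_n}$, with vanishing ideal $I(X)\subset S=K[t_1,\ldots,t_n]$. Let $\beta$ be a generator of the cyclic group $K^*$ and let $d_i$ be the order of $\beta^{v_i}$ in $K^*$. Let $I'\subset S$ be the ideal $(t_i^{c_{ij}}-t_j^{c_{ij}} : 1\le i<j\le n)$, where $c_{ij}=\mathrm{lcm}\{d_i,d_j\}$. If $\gcd(d_1,\ldots,d_n)=1$, then $I(X)=(I'\colon(t_1\cdots t_n)^\infty)$.
   Context: $X=\{[(x_1^{v_1},\ldots,x_n^{v_n})] : x_i\in K^*\text{ for all }i\}\subset\mathbb{P}^{n-1}$, where $\mathbb{P}^{n-1}$ is the projective space over $K$ and $K^*=K\setminus\{0\}$. $S=K[t_1,\ldots,t_n]$ has the standard grading, and $I(X)$ is the ideal of $S$ generated by the homogeneous polynomials that vanish at all points of $X$. For an ideal $I\subset S$ and $h\in S$, the saturation of $I$ with respect to $h$ is $(I\colon h^\infty)=\{f\in S : fh^k\in I\text{ for some }k\ge 1\}$. *)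

theory Defs
  imports
    "HOL-Analysis.Finite_Cartesian_Product"
    "HOL-Library.Poly_Mapping"
    "HOL-Algebra.Multiplicative_Group"
begin

text \<open>
  Polynomials over \<open>'k\<close> in the variables \<open>t\<^sub>i\<close>, \<open>i :: 'n\<close>: finitely supported
  maps from exponent vectors to coefficients; the ring structure (convolution product)
  is the one provided by \<^theory>\<open>HOL-Library.Poly_Mapping\<close>.
\<close>

type_synonym ('n, 'k) mpoly = "('n \<Rightarrow>\<^sub>0 nat) \<Rightarrow>\<^sub>0 'k"

definition tvar :: "'n \<Rightarrow> ('n, 'k::comm_ring_1) mpoly"
  where "tvar i = Poly_Mapping.single (Poly_Mapping.single i 1) 1"

definition mpoly_eval :: "('n::finite, 'k::comm_ring_1) mpoly \<Rightarrow> 'k ^ 'n \<Rightarrow> 'k"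
  where "mpoly_eval f x =
    (\<Sum>m\<in>Poly_Mapping.keys f.
       Poly_Mapping.lookup f m * (\<Prod>i\<in>UNIV. (x $ i) ^ Poly_Mapping.lookup m i))"

definition homogeneous :: "('n::finite, 'k::comm_ring_1) mpoly \<Rightarrow> bool"
  where "homogeneous f \<longleftrightarrow>
    (\<exists>e. \<forall>m\<in>Poly_Mapping.keys f. (\<Sum>i\<in>UNIV. Poly_Mapping.lookup m i) = e)"


text \<open>
  The ideals of a commutative ring are its submodules, with the ring acting on itself by
  multiplication. The name is qualified because HOL-Algebra also has a locale \<open>module\<close>.
\<close>

lemma module_times: "Modules.module ((*) :: 'a::comm_ring_1 \<Rightarrow> 'a \<Rightarrow> 'a)"
  by unfold_locales (simp_all add: algebra_simps)

definition ideal_gen :: "'a::comm_ring_1 set \<Rightarrow> 'a set"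
  where "ideal_gen B = Modules.module.span (*) B"

definition saturation :: "'a::comm_ring_1 set \<Rightarrow> 'a \<Rightarrow> 'a set"
  where "saturation I h = {f. \<exists>k\<ge>1. f * h ^ k \<in> I}"


text \<open>Points of projective space are classes of nonzero vectors up to nonzero scalars.\<close>

definition proj_rel :: "('k::field ^ 'n) rel"
  where "proj_rel = {(x, y). x \<noteq> 0 \<and> y \<noteq> 0 \<and> (\<exists>c. c \<noteq> 0 \<and> y = c *s x)}"

definition proj_space :: "('k::field ^ 'n) set set"
  where "proj_space = (UNIV - {0}) // proj_rel"

definition vanishes_at :: "('n::finite, 'k::field) mpoly \<Rightarrow> ('k ^ 'n) set \<Rightarrow> bool"
  where "vanishes_at f P \<longleftrightarrow> (\<forall>x\<in>P. mpoly_eval f x = 0)"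

definition vanishing_ideal :: "('k::field ^ 'n::finite) set set \<Rightarrow> ('n, 'k) mpoly set"
  where "vanishing_ideal X = ideal_gen {f. homogeneous f \<and> (\<forall>P\<in>X. vanishes_at f P)}"

definition degenerate_torus :: "('n \<Rightarrow> nat) \<Rightarrow> ('k::field ^ 'n) set set"
  where "degenerate_torus v =
    {proj_rel `` {\<chi> i. (x $ i) ^ v i} | x. \<forall>i. x $ i \<noteq> 0}"

lemma equiv_proj_rel: "equiv (UNIV - {0}) (proj_rel :: ('k::field ^ 'n::finite) rel)"
proof (rule equivI)
  show "(proj_rel :: ('k ^ 'n) rel) \<subseteq> (UNIV - {0}) \<times> (UNIV - {0})"
    by (auto simp: proj_rel_def)
  show "refl_on (UNIV - {0}) (proj_rel :: ('k ^ 'n) rel)"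
    by (auto simp: refl_on_def proj_rel_def intro!: exI[of _ 1])
  show "sym (proj_rel :: ('k ^ 'n) rel)"
  proof (rule symI)
    fix x y :: "'k ^ 'n"
    assume "(x, y) \<in> proj_rel"
    then obtain c where c: "x \<noteq> 0" "y \<noteq> 0" "c \<noteq> 0" "y = c *s x"
      by (auto simp: proj_rel_def)
    then have "x = inverse c *s y" by (simp add: vec_eq_iff)
    moreover from c have "inverse c \<noteq> 0" by simp
    ultimately show "(y, x) \<in> proj_rel"
      using c(1,2) unfolding proj_rel_def by blast
  qed
  show "trans (proj_rel :: ('k ^ 'n) rel)"
  proof (rule transI)
    fix x y z :: "'k ^ 'n"
    assume "(x, y) \<in> proj_rel" "(y, z) \<in> proj_rel"
    then obtain b c where *: "x \<noteq> 0" "z \<noteq> 0" "b \<noteq> 0" "c \<noteq> 0" "y = b *s x" "z = c *s y"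
      by (auto simp: proj_rel_def)
    then have "z = (c * b) *s x" by (simp add: vec_eq_iff mult.assoc)
    moreover from * have "c * b \<noteq> 0" by simp
    ultimately show "(x, z) \<in> proj_rel"
      using *(1,2) unfolding proj_rel_def by blast
  qed
qed

lemma degenerate_torus_subset:
  "degenerate_torus v \<subseteq> (proj_space :: ('k::field ^ 'n::finite) set set)"
proof
  fix P :: "('k ^ 'n) set"
  assume "P \<in> degenerate_torus v"
  then obtain x :: "'k ^ 'n" where x: "\<forall>i. x $ i \<noteq> 0"
    and P: "P = proj_rel `` {\<chi> i. (x $ i) ^ v i}"
    unfolding degenerate_torus_def by blast
  have "(\<chi> i. (x $ i) ^ v i) $ j \<noteq> 0" for j
    using x by simp
  then have "(\<chi> i. (x $ i) ^ v i) \<noteq> 0"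
    by (metis zero_index)
  then show "P \<in> proj_space"
    unfolding P proj_space_def by (intro quotientI) simp
qed


definition unit_group :: "'k::field monoid"
  where "unit_group = \<lparr>carrier = UNIV - {0}, monoid.mult = (*), one = 1\<rparr>"

lemma group_unit_group: "group (unit_group :: 'k::field monoid)"
proof (rule groupI)
  fix x :: 'k
  assume "x \<in> carrier unit_group"
  then show "\<exists>y\<in>carrier unit_group. y \<otimes>\<^bsub>unit_group\<^esub> x = \<one>\<^bsub>unit_group\<^esub>"
    by (auto simp: unit_group_def intro!: bexI[of _ "inverse x"])
qed (auto simp: unit_group_def)

end

theory Submission
  imports Defs "HOL-Computational_Algebra.Polynomial"
begin

text \<open>
  If \<open>f h\<^sup>k \<in> I'\<close> with \<open>h = t\<^sub>1 \<cdots> t\<^sub>n\<close>, restricting to the line through a point of \<open>X\<close> kills the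
  generators of \<open>I'\<close> but not \<open>h\<close>, so every homogeneous component of \<open>f\<close> vanishes on \<open>X\<close>.
  Conversely, a homogeneous \<open>f\<close> vanishing on \<open>X\<close> is, by linear independence of characters, a
  combination of binomials \<open>t\<^sup>a - t\<^sup>b\<close> with \<open>|a| = |b|\<close> and \<open>d\<^sub>i\<close> dividing \<open>a\<^sub>i - b\<^sub>i\<close> for all \<open>i\<close>.
  Writing \<open>a\<^sub>i - b\<^sub>i = d\<^sub>i m\<^sub>i\<close>, the vector \<open>m\<close> is a syzygy of \<open>(d\<^sub>1, \<dots>, d\<^sub>n)\<close>; as the \<open>d\<^sub>i\<close> are coprime,
  the Koszul syzygies generate, and they correspond to multiples of the generators of \<open>I'\<close>.
\<close>

section \<open>Ideals and saturations\<close>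

text \<open>Interpreting \<^locale>\<open>Modules.module\<close> for \<open>(*)\<close> would declare reversed associativity as a
  simp rule, so the facts are instantiated one by one.\<close>

abbreviation is_ideal :: "'a::comm_ring_1 set \<Rightarrow> bool"
  where "is_ideal \<equiv> Modules.module.subspace (*)"

lemmas is_idealI = Modules.module.subspaceI[OF module_times]
lemmas is_ideal_0 = Modules.module.subspace_0[OF module_times]
lemmas is_ideal_add = Modules.module.subspace_add[OF module_times]
lemmas is_ideal_scale = Modules.module.subspace_scale[OF module_times]
lemmas is_ideal_neg = Modules.module.subspace_neg[OF module_times]
lemmas is_ideal_sum = Modules.module.subspace_sum[OF module_times]

lemma is_ideal_ideal_gen: "is_ideal (ideal_gen B)"
  unfolding ideal_gen_def by (rule Modules.module.subspace_span[OF module_times])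

lemma ideal_gen_base: "a \<in> B \<Longrightarrow> a \<in> ideal_gen B"
  unfolding ideal_gen_def by (rule Modules.module.span_base[OF module_times])

lemma ideal_gen_minimal: "B \<subseteq> T \<Longrightarrow> is_ideal T \<Longrightarrow> ideal_gen B \<subseteq> T"
  unfolding ideal_gen_def by (rule Modules.module.span_minimal[OF module_times])

lemma ideal_mult_right: "is_ideal J \<Longrightarrow> f \<in> J \<Longrightarrow> f * g \<in> J"
  using is_ideal_scale[of J f g] by (simp add: mult.commute)

lemma subset_saturation:
  assumes "is_ideal I"
  shows "I \<subseteq> saturation I h"
proof
  fix f assume "f \<in> I"
  then have "f * h ^ 1 \<in> I" by (rule ideal_mult_right[OF assms])
  then show "f \<in> saturation I h" unfolding saturation_def by blast
qed

lemma is_ideal_saturation: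
  assumes I: "is_ideal I"
  shows "is_ideal (saturation I h)"
proof (rule is_idealI)
  show "0 \<in> saturation I h"
    using is_ideal_0[OF I] by (simp add: saturation_def exI[of _ 1])
next
  fix f g assume "f \<in> saturation I h" "g \<in> saturation I h"
  then obtain k l where kl: "k \<ge> 1" "f * h ^ k \<in> I" "g * h ^ l \<in> I"
    unfolding saturation_def by blast
  have "(f + g) * h ^ (k + l) = f * h ^ k * h ^ l + g * h ^ l * h ^ k"
    by (simp add: power_add algebra_simps)
  also have "\<dots> \<in> I"
    by (rule is_ideal_add[OF I ideal_mult_right[OF I kl(2)] ideal_mult_right[OF I kl(3)]])
  finally show "f + g \<in> saturation I h"
    using kl(1) unfolding saturation_def by (intro CollectI exI[of _ "k + l"]) simp
next
  fix c f assume "f \<in> saturation I h"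
  then obtain k where k: "k \<ge> 1" "f * h ^ k \<in> I"
    unfolding saturation_def by blast
  from is_ideal_scale[OF I this(2), of c] have "c * f * h ^ k \<in> I"
    by (simp add: mult.assoc)
  with k(1) show "c * f \<in> saturation I h" unfolding saturation_def by blast
qed

text \<open>The exponents add up: a power of \<open>h\<close> that brings \<open>f * h ^ N\<close>
  into \<open>I\<close> combines with \<open>h ^ N\<close>.\<close>

lemma saturation_cancel_power:
  assumes "f * h ^ N \<in> saturation I h"
  shows "f \<in> saturation I h"
proof -
  obtain k where "k \<ge> 1" "f * h ^ N * h ^ k \<in> I"
    using assms unfolding saturation_def by blast
  then have "N + k \<ge> 1" "f * h ^ (N + k) \<in> I"
    by (simp_all add: power_add mult.assoc)
  then show ?thesis unfolding saturation_def by blast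
qed


section \<open>Monomials\<close>

abbreviation mon :: "('n \<Rightarrow>\<^sub>0 nat) \<Rightarrow> ('n, 'k::comm_ring_1) mpoly"
  where "mon a \<equiv> Poly_Mapping.single a 1"

lemma mon_add: "mon (a + b) = mon a * mon b"
  by (simp add: mult_single)

lemma tvar_power: "tvar i ^ l = mon (Poly_Mapping.single i l)"
  by (induction l) (simp_all add: tvar_def mult_single flip: single_add)

lemma prod_tvar_power:
  "(\<Prod>i\<in>A. tvar i) ^ N = mon (\<Sum>i\<in>A. Poly_Mapping.single i N)"
proof (induction A rule: infinite_finite_induct)
  case (insert x F)
  then show ?case by (simp add: power_mult_distrib tvar_power mon_add)
qed simp_all

lemma lookup_sum_single:
  "finite A \<Longrightarrow> i \<in> A \<Longrightarrow> Poly_Mapping.lookup (\<Sum>j\<in>A. Poly_Mapping.single j N) i = N"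
  by (simp add: lookup_sum lookup_single when_def)

lemma lookup_Abs_finite [simp]:
  "Poly_Mapping.lookup (Abs_poly_mapping f) = f" for f :: "'n::finite \<Rightarrow> 'b::zero"
  by (rule lookup_Abs_poly_mapping) simp

lemma poly_mapping_sum_single:
  "f = (\<Sum>m\<in>Poly_Mapping.keys f. Poly_Mapping.single m (Poly_Mapping.lookup f m))"
proof (rule poly_mapping_eqI)
  fix k
  show "Poly_Mapping.lookup f k =
    Poly_Mapping.lookup (\<Sum>m\<in>Poly_Mapping.keys f. Poly_Mapping.single m (Poly_Mapping.lookup f m)) k"
    by (simp add: lookup_sum lookup_single when_def in_keys_iff)
qed

text \<open>Every monomial divides a power of the product of all variables, so monomials can be
  cancelled modulo the saturation.\<close>

lemma saturation_cancel_mon: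
  fixes f :: "('n::finite, 'k::comm_ring_1) mpoly"
  assumes I: "is_ideal I"
    and f: "f * mon w \<in> saturation I (\<Prod>i\<in>UNIV. tvar i)"
  shows "f \<in> saturation I (\<Prod>i\<in>UNIV. tvar i)"
proof -
  \<comment> \<open>The total degree bounds every exponent of \<open>w\<close>, so
    \<open>mon u\<close> is the complementary factor and the subtraction in \<open>u\<close> is
    exact.\<close>
  define N where "N = (\<Sum>i\<in>UNIV. Poly_Mapping.lookup w i)"
  define u where "u = Abs_poly_mapping (\<lambda>i. N - Poly_Mapping.lookup w i)"
  have le: "Poly_Mapping.lookup w i \<le> N" for i
    unfolding N_def by (rule member_le_sum) auto
  have "w + u = (\<Sum>i\<in>UNIV. Poly_Mapping.single i N)"
    by (rule poly_mapping_eqI) (simp add: lookup_add lookup_sum_single u_def le)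
  then have "f * (\<Prod>i\<in>UNIV. tvar i) ^ N = f * mon w * mon u"
    by (simp add: prod_tvar_power mult.assoc flip: mon_add)
  with ideal_mult_right[OF is_ideal_saturation[OF I] f, of "mon u"]
  have "f * (\<Prod>i\<in>UNIV. tvar i) ^ N \<in> saturation I (\<Prod>i\<in>UNIV. tvar i)"
    by simp
  then show ?thesis by (rule saturation_cancel_power)
qed


section \<open>Restriction of a polynomial to a line through the origin\<close>

text \<open>Over a finite field the values on a line do not determine the homogeneous components;
  the univariate polynomial \<open>f (T x)\<close> does: its coefficients are their values at \<open>x\<close>.\<close>

definition mon_eval :: "'k::comm_ring_1 ^ 'n::finite \<Rightarrow> ('n \<Rightarrow>\<^sub>0 nat) \<Rightarrow> 'k"
  where "mon_eval x m = (\<Prod>i\<in>UNIV. (x $ i) ^ Poly_Mapping.lookup m i)"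

definition mon_degree :: "('n::finite \<Rightarrow>\<^sub>0 nat) \<Rightarrow> nat"
  where "mon_degree m = (\<Sum>i\<in>UNIV. Poly_Mapping.lookup m i)"

definition line_eval :: "'k::comm_ring_1 ^ 'n::finite \<Rightarrow> ('n, 'k) mpoly \<Rightarrow> 'k poly"
  where "line_eval x f =
    (\<Sum>m\<in>Poly_Mapping.keys f.
      Polynomial.monom (Poly_Mapping.lookup f m * mon_eval x m) (mon_degree m))"

lemma mon_eval_add: "mon_eval x (a + b) = mon_eval x a * mon_eval x b"
  by (simp add: mon_eval_def lookup_add power_add prod.distrib)

lemma mon_eval_single: "mon_eval x (Poly_Mapping.single i l) = x $ i ^ l"
proof -
  have "mon_eval x (Poly_Mapping.single i l) = (\<Prod>j\<in>UNIV. if i = j then x $ j ^ l else 1)"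
    unfolding mon_eval_def by (rule prod.cong) (auto simp: lookup_single when_def)
  then show ?thesis by simp
qed

lemma mon_degree_add: "mon_degree (a + b) = mon_degree a + mon_degree b"
  by (simp add: mon_degree_def lookup_add sum.distrib)

lemma mon_degree_single [simp]: "mon_degree (Poly_Mapping.single i l) = l"
  by (simp add: mon_degree_def lookup_single when_def)

lemma line_eval_superset:
  assumes "finite A" "Poly_Mapping.keys f \<subseteq> A"
  shows "line_eval x f =
    (\<Sum>m\<in>A. Polynomial.monom (Poly_Mapping.lookup f m * mon_eval x m) (mon_degree m))"
  unfolding line_eval_def using assms
  by (intro sum.mono_neutral_left) (auto simp: in_keys_iff)

lemma line_eval_zero [simp]: "line_eval x 0 = 0"
  by (simp add: line_eval_def)

lemma line_eval_single:
  "line_eval x (Poly_Mapping.single m c) = Polynomial.monom (c * mon_eval x m) (mon_degree m)"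
  by (subst line_eval_superset[of "{m}"]) simp_all

lemma line_eval_add: "line_eval x (f + g) = line_eval x f + line_eval x g"
proof -
  let ?A = "Poly_Mapping.keys f \<union> Poly_Mapping.keys g"
  have "Poly_Mapping.keys (f + g) \<subseteq> ?A" by (rule keys_add)
  then show ?thesis
    by (simp add: line_eval_superset[of ?A] lookup_add distrib_right flip: add_monom sum.distrib)
qed

lemma line_eval_diff: "line_eval x (f - g) = line_eval x f - line_eval x g"
  using line_eval_add[of x "f - g" g] by simp

lemma line_eval_sum: "line_eval x (sum f A) = (\<Sum>a\<in>A. line_eval x (f a))"
  by (induction A rule: infinite_finite_induct) (simp_all add: line_eval_add)

text \<open>Expanding both factors reduces this to monomials. It makes \<open>line_eval x\<close> a
  ring homomorphism to \<open>'k poly\<close>.\<close>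

lemma line_eval_mult: "line_eval x (f * g) = line_eval x f * line_eval x g"
proof -
  let ?s = "\<lambda>h m. Poly_Mapping.single m (Poly_Mapping.lookup h m)"
  have "f * g = (\<Sum>m\<in>Poly_Mapping.keys f. ?s f m) * (\<Sum>m\<in>Poly_Mapping.keys g. ?s g m)"
    by (simp flip: poly_mapping_sum_single)
  then have "line_eval x (f * g) =
      (\<Sum>a\<in>Poly_Mapping.keys f. \<Sum>b\<in>Poly_Mapping.keys g. line_eval x (?s f a * ?s g b))"
    by (simp only: sum_product line_eval_sum)
  also have "\<dots> = (\<Sum>a\<in>Poly_Mapping.keys f. \<Sum>b\<in>Poly_Mapping.keys g.
      Polynomial.monom (Poly_Mapping.lookup f a * mon_eval x a) (mon_degree a) *
      Polynomial.monom (Poly_Mapping.lookup g b * mon_eval x b) (mon_degree b))"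
    by (simp add: mult_single line_eval_single mult_monom mon_eval_add mon_degree_add ac_simps)
  also have "\<dots> = line_eval x f * line_eval x g"
    unfolding line_eval_def sum_product ..
  finally show ?thesis .
qed

lemma line_eval_tvar_power:
  "line_eval x (tvar i ^ l) = Polynomial.monom (x $ i ^ l) l"
  by (simp add: tvar_power line_eval_single mon_eval_single)

lemma line_eval_prod_tvar_power_nonzero:
  fixes x :: "'k::field ^ 'n::finite"
  assumes "\<And>i. x $ i \<noteq> 0"
  shows "line_eval x ((\<Prod>i\<in>UNIV. tvar i) ^ N) \<noteq> 0"
  using assms by (simp add: prod_tvar_power line_eval_single mon_eval_def)

lemma is_ideal_line_eval_kernel: "is_ideal {f. line_eval x f = 0}"
  by (rule is_idealI) (auto simp: line_eval_add line_eval_mult)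

section \<open>Homogeneous components and membership in the vanishing ideal\<close>

definition hom_component :: "nat \<Rightarrow> ('n::finite, 'k::comm_ring_1) mpoly \<Rightarrow> ('n, 'k) mpoly"
  where "hom_component e f =
    (\<Sum>m | m \<in> Poly_Mapping.keys f \<and> mon_degree m = e.
      Poly_Mapping.single m (Poly_Mapping.lookup f m))"

lemma lookup_hom_component:
  "Poly_Mapping.lookup (hom_component e f) m =
    (if mon_degree m = e then Poly_Mapping.lookup f m else 0)"
  by (auto simp: hom_component_def lookup_sum lookup_single when_def in_keys_iff)

lemma keys_hom_component:
  "Poly_Mapping.keys (hom_component e f) = {m \<in> Poly_Mapping.keys f. mon_degree m = e}"
  by (auto simp: in_keys_iff lookup_hom_component split: if_splits)

lemma homogeneous_hom_component: "homogeneous (hom_component e f)"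
  unfolding homogeneous_def by (auto simp: keys_hom_component mon_degree_def)

lemma mpoly_eval_hom_component:
  "mpoly_eval (hom_component e f) x = Polynomial.coeff (line_eval x f) e"
proof -
  have "mpoly_eval (hom_component e f) x =
      (\<Sum>m | m \<in> Poly_Mapping.keys f \<and> mon_degree m = e. Poly_Mapping.lookup f m * mon_eval x m)"
    unfolding mpoly_eval_def keys_hom_component
    by (rule sum.cong) (auto simp: lookup_hom_component mon_eval_def)
  also have "\<dots> = (\<Sum>m\<in>Poly_Mapping.keys f.
      if mon_degree m = e then Poly_Mapping.lookup f m * mon_eval x m else 0)"
    by (simp add: sum.inter_filter)
  also have "\<dots> = Polynomial.coeff (line_eval x f) e"
    by (simp add: line_eval_def Polynomial.coeff_sum)
  finally show ?thesis .
qed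

lemma sum_hom_components:
  "(\<Sum>e\<in>mon_degree ` Poly_Mapping.keys f. hom_component e f) = f"
proof -
  have "(\<Sum>e\<in>mon_degree ` Poly_Mapping.keys f. hom_component e f) =
      (\<Sum>m\<in>Poly_Mapping.keys f. Poly_Mapping.single m (Poly_Mapping.lookup f m))"
    unfolding hom_component_def by (rule sum.image_gen[symmetric]) simp
  then show ?thesis by (simp flip: poly_mapping_sum_single)
qed

text \<open>The values of the components of \<open>f\<close> on \<open>X\<close> are coefficients of
  the zero polynomial, so each component is one of the generators and \<open>f\<close> is their
  sum.\<close>

lemma vanishing_idealI:
  assumes "\<And>P x. P \<in> X \<Longrightarrow> x \<in> P \<Longrightarrow> line_eval x f = 0"
  shows "f \<in> vanishing_ideal X"
proof -
  have "hom_component e f \<in> vanishing_ideal X" for e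
    unfolding vanishing_ideal_def using assms
    by (intro ideal_gen_base)
      (auto simp: homogeneous_hom_component vanishes_at_def mpoly_eval_hom_component)
  then have "(\<Sum>e\<in>mon_degree ` Poly_Mapping.keys f. hom_component e f) \<in> vanishing_ideal X"
    unfolding vanishing_ideal_def by (intro is_ideal_sum[OF is_ideal_ideal_gen])
  then show ?thesis by (simp add: sum_hom_components)
qed


section \<open>Independence of characters\<close>

text \<open>Dedekind's argument by induction on the number of characters. The operation is a
  parameter because it is applied to exponent vectors under pointwise addition.\<close>

lemma characters_independent:
  fixes X :: "('a \<Rightarrow> 'k::idom) set" and opr :: "'a \<Rightarrow> 'a \<Rightarrow> 'a"
  assumes "finite X"
    and "\<And>\<rho> x y. \<rho> \<in> X \<Longrightarrow> \<rho> (opr x y) = \<rho> x * \<rho> y"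
    and "\<And>\<rho>. \<rho> \<in> X \<Longrightarrow> \<exists>x. \<rho> x \<noteq> 0"
    and "\<And>x. (\<Sum>\<rho>\<in>X. c \<rho> * \<rho> x) = 0"
    and "\<rho> \<in> X"
  shows "c \<rho> = 0"
  using assms
proof (induction X arbitrary: c \<rho> rule: finite_induct)
  case (insert \<psi> X)
  have X0: "c \<phi> = 0" if \<phi>: "\<phi> \<in> X" for \<phi>
  proof -
    from \<phi> insert.hyps have "\<phi> \<noteq> \<psi>" by auto
    then obtain y where y: "\<phi> y \<noteq> \<psi> y" by blast
    \<comment> \<open>Subtracting \<open>\<psi> y\<close> times the relation at \<open>x\<close>
      from the relation at \<open>opr y x\<close> eliminates \<open>\<psi>\<close>.\<close>
    have "(\<Sum>\<rho>\<in>X. c \<rho> * (\<rho> y - \<psi> y) * \<rho> x) = 0" for x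
    proof -
      have 1: "(\<Sum>\<rho>\<in>insert \<psi> X. c \<rho> * (\<rho> y * \<rho> x)) = 0"
        using insert.prems(1) insert.prems(3)[of "opr y x"] by simp
      have 2: "\<psi> y * (\<Sum>\<rho>\<in>insert \<psi> X. c \<rho> * \<rho> x) = 0"
        using insert.prems(3)[of x] by simp
      have "(\<Sum>\<rho>\<in>X. c \<rho> * (\<rho> y - \<psi> y) * \<rho> x) =
          (\<Sum>\<rho>\<in>insert \<psi> X. c \<rho> * (\<rho> y * \<rho> x)) - \<psi> y * (\<Sum>\<rho>\<in>insert \<psi> X. c \<rho> * \<rho> x)"
        using insert.hyps by (simp add: algebra_simps sum_distrib_left sum_subtractf)
      then show ?thesis unfolding 1 2 by simp
    qed
    then have "c \<phi> * (\<phi> y - \<psi> y) = 0"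
      using insert.prems(1,2) \<phi>
      by (intro insert.IH[where c = "\<lambda>\<rho>. c \<rho> * (\<rho> y - \<psi> y)" and \<rho> = \<phi>]) simp_all
    then show ?thesis using y by simp
  qed
  obtain x where "\<psi> x \<noteq> 0" using insert.prems(2) by blast
  moreover have "c \<psi> * \<psi> x = 0"
    using insert.prems(3)[of x] insert.hyps X0 by simp
  ultimately have "c \<psi> = 0" by simp
  with X0 insert.prems(4) show ?case by auto
qed simp


section \<open>Lattices of binomials\<close>

text \<open>Integer exponent differences whose binomials lie in \<open>J\<close>. Quantifying over
  all \<open>a\<close>, \<open>b\<close> with difference \<open>c\<close> avoids choosing a
  representative. If \<open>J\<close> is an ideal in which monomials cancel, this is a subgroup of
  the integer vectors.\<close>

definition binomial_lattice :: "('n, 'k::comm_ring_1) mpoly set \<Rightarrow> ('n \<Rightarrow> int) set"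
  where "binomial_lattice J =
    {c. \<forall>a b. (\<forall>i. int (Poly_Mapping.lookup a i) - int (Poly_Mapping.lookup b i) = c i) \<longrightarrow>
      mon a - mon b \<in> J}"

lemma binomial_latticeD:
  assumes "c \<in> binomial_lattice J"
    and "\<And>i. int (Poly_Mapping.lookup a i) - int (Poly_Mapping.lookup b i) = c i"
  shows "mon a - mon b \<in> J"
  using assms by (auto simp: binomial_lattice_def)

context
  fixes J :: "('n::finite, 'k::comm_ring_1) mpoly set"
  assumes J: "is_ideal J"
    and cancel: "\<And>f w. f * mon w \<in> J \<Longrightarrow> f \<in> J"
begin

lemma binomial_lattice_zero: "(\<lambda>_. 0) \<in> binomial_lattice J"
  unfolding binomial_lattice_def
proof (intro CollectI allI impI)
  fix a b :: "'n \<Rightarrow>\<^sub>0 nat"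
  assume "\<forall>i. int (Poly_Mapping.lookup a i) - int (Poly_Mapping.lookup b i) = 0"
  then have "a = b" by (intro poly_mapping_eqI) simp
  then show "mon a - mon b \<in> J" using is_ideal_0[OF J] by simp
qed

lemma binomial_lattice_uminus:
  assumes "c \<in> binomial_lattice J"
  shows "(\<lambda>i. - c i) \<in> binomial_lattice J"
  unfolding binomial_lattice_def
proof (intro CollectI allI impI)
  fix a b :: "'n \<Rightarrow>\<^sub>0 nat"
  assume ab: "\<forall>i. int (Poly_Mapping.lookup a i) - int (Poly_Mapping.lookup b i) = - c i"
  have "int (Poly_Mapping.lookup b i) - int (Poly_Mapping.lookup a i) = c i" for i
    using ab[rule_format, of i] by simp
  then have "- (mon b - mon a) \<in> J"
    by (intro is_ideal_neg[OF J] binomial_latticeD[OF assms])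
  then show "mon a - mon b \<in> J" by simp
qed

lemma binomial_lattice_add:
  assumes c: "c \<in> binomial_lattice J" and c': "c' \<in> binomial_lattice J"
  shows "(\<lambda>i. c i + c' i) \<in> binomial_lattice J"
  unfolding binomial_lattice_def
proof (intro CollectI allI impI)
  fix a b :: "'n \<Rightarrow>\<^sub>0 nat"
  assume ab: "\<forall>i. int (Poly_Mapping.lookup a i) - int (Poly_Mapping.lookup b i) = c i + c' i"
  \<comment> \<open>The exponent \<open>a - c\<close> may be negative; the shift by \<open>w\<close>
    makes \<open>x = a + w - c\<close> a genuine intermediate monomial. The binomials telescope and
    \<open>mon w\<close> is cancelled.\<close>
  define w where "w = Abs_poly_mapping (\<lambda>i. nat \<bar>c i\<bar>)"
  define x where "x = Abs_poly_mapping (\<lambda>i. nat (int (Poly_Mapping.lookup a i) + \<bar>c i\<bar> - c i))"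
  have "mon (a + w) - mon x \<in> J"
    by (rule binomial_latticeD[OF c]) (simp add: lookup_add w_def x_def)
  moreover have "mon x - mon (b + w) \<in> J"
  proof (rule binomial_latticeD[OF c'])
    fix i
    show "int (Poly_Mapping.lookup x i) - int (Poly_Mapping.lookup (b + w) i) = c' i"
      using ab[rule_format, of i] by (auto simp: lookup_add w_def x_def)
  qed
  ultimately have "(mon (a + w) - mon x) + (mon x - mon (b + w)) \<in> J"
    by (rule is_ideal_add[OF J])
  then have "(mon a - mon b) * mon w \<in> J"
    by (simp add: mon_add algebra_simps)
  then show "mon a - mon b \<in> J" by (rule cancel)
qed

lemma binomial_lattice_sum:
  assumes "\<And>x. x \<in> A \<Longrightarrow> c x \<in> binomial_lattice J"
  shows "(\<lambda>i. \<Sum>x\<in>A. c x i) \<in> binomial_lattice J"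
  using assms
proof (induction A rule: infinite_finite_induct)
  case (insert x F)
  then show ?case using binomial_lattice_add by simp
qed (simp_all add: binomial_lattice_zero)

lemma binomial_lattice_scale:
  assumes c: "c \<in> binomial_lattice J"
  shows "(\<lambda>i. z * c i) \<in> binomial_lattice J"
proof -
  have nat: "(\<lambda>i. int k * c i) \<in> binomial_lattice J" for k
    using binomial_lattice_sum[of "{..<k}" "\<lambda>_. c"] c by simp
  show ?thesis
  proof (cases "z \<ge> 0")
    case True
    then show ?thesis using nat[of "nat z"] by simp
  next
    case False
    then show ?thesis using binomial_lattice_uminus[OF nat[of "nat (- z)"]] by simp
  qed
qed

text \<open>Any binomial with this exponent difference is a monomial multiple of
  \<open>tvar i ^ l - tvar j ^ l\<close>.\<close>

lemma binomial_lattice_tvar: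
  assumes "tvar i ^ l - tvar j ^ l \<in> J" "i \<noteq> j"
  shows "(\<lambda>k. int l * (of_bool (k = i) - of_bool (k = j))) \<in> binomial_lattice J"
  unfolding binomial_lattice_def
proof (intro CollectI allI impI)
  fix a b :: "'n \<Rightarrow>\<^sub>0 nat"
  assume ab: "\<forall>k. int (Poly_Mapping.lookup a k) - int (Poly_Mapping.lookup b k) =
    int l * (of_bool (k = i) - of_bool (k = j))"
  \<comment> \<open>The subtraction does not truncate: since \<open>i \<noteq> j\<close>, the
    exponent of \<open>b\<close> at \<open>j\<close> exceeds that of \<open>a\<close> by
    \<open>l\<close>.\<close>
  define w where "w = Abs_poly_mapping (\<lambda>k. Poly_Mapping.lookup b k - (if k = j then l else 0))"
  have "b = w + Poly_Mapping.single j l"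
  proof (rule poly_mapping_eqI)
    fix k
    show "Poly_Mapping.lookup b k = Poly_Mapping.lookup (w + Poly_Mapping.single j l) k"
      using ab[rule_format, of k] assms(2)
      by (auto simp: w_def lookup_add lookup_single when_def split: if_splits)
  qed
  moreover have "a = w + Poly_Mapping.single i l"
  proof (rule poly_mapping_eqI)
    fix k
    show "Poly_Mapping.lookup a k = Poly_Mapping.lookup (w + Poly_Mapping.single i l) k"
      using ab[rule_format, of k] assms(2)
      by (auto simp: w_def lookup_add lookup_single when_def split: if_splits)
  qed
  ultimately have "mon a - mon b = (mon w :: ('n, 'k) mpoly) * (tvar i ^ l - tvar j ^ l)"
    by (simp add: mon_add tvar_power algebra_simps)
  then show "mon a - mon b \<in> J"
    using is_ideal_scale[OF J assms(1)] by simp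
qed

text \<open>With \<open>\<Sum>\<^sub>j u\<^sub>j d\<^sub>j = 1\<close>, any \<open>c = (d\<^sub>i m\<^sub>i)\<close> with \<open>\<Sum>\<^sub>i c\<^sub>i = 0\<close> is the combination
  \<open>\<Sum>\<^sub>i\<^sub>,\<^sub>j u\<^sub>j m\<^sub>i d\<^sub>i d\<^sub>j (e\<^sub>i - e\<^sub>j)\<close> of Koszul syzygies, in which \<open>lcm d\<^sub>i d\<^sub>j\<close> divides
  \<open>d\<^sub>i d\<^sub>j\<close>.\<close>

lemma syzygy_in_binomial_lattice:
  fixes c u :: "'n \<Rightarrow> int" and d :: "'n \<Rightarrow> nat"
  assumes gens: "\<And>i j. i \<noteq> j \<Longrightarrow>
      (\<lambda>k. int (lcm (d i) (d j)) * (of_bool (k = i) - of_bool (k = j))) \<in> binomial_lattice J"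
    and u: "(\<Sum>i\<in>UNIV. u i * int (d i)) = 1"
    and c: "(\<Sum>i\<in>UNIV. c i) = 0" "\<And>i. int (d i) dvd c i"
  shows "c \<in> binomial_lattice J"
proof -
  obtain m where m: "\<And>i. c i = int (d i) * m i"
    using c(2) unfolding dvd_def by metis
  define e where "e = (\<lambda>i j k. u j * m i * int (d i * d j) * (of_bool (k = i) - of_bool (k = j)))"
  have "e i j \<in> binomial_lattice J" for i j
  proof (cases "i = j")
    case True
    then show ?thesis using binomial_lattice_zero by (simp add: e_def)
  next
    case False
    obtain r where "int (d i * d j) = int (lcm (d i) (d j)) * r"
      by (metis dvd_def int_dvd_int_iff dvd_triv_left dvd_triv_right lcm_least)
    then have "e i j = (\<lambda>k. (u j * m i * r) *
        (int (lcm (d i) (d j)) * (of_bool (k = i) - of_bool (k = j))))"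
      unfolding e_def by (simp add: ac_simps)
    then show ?thesis
      using binomial_lattice_scale[OF gens[OF False]] by simp
  qed
  then have "(\<lambda>k. \<Sum>i\<in>UNIV. \<Sum>j\<in>UNIV. e i j k) \<in> binomial_lattice J"
    by (intro binomial_lattice_sum[where c = "\<lambda>i k. \<Sum>j\<in>UNIV. e i j k"]
        binomial_lattice_sum[where c = "e i" for i])
  moreover have "(\<Sum>i\<in>UNIV. \<Sum>j\<in>UNIV. e i j k) = c k" for k
  proof -
    \<comment> \<open>Splitting \<open>e\<close> along its two indicators gives two products of
      sums: the first is \<open>c k\<close> times the Bezout sum \<open>1\<close>, the second
      contains the factor \<open>(\<Sum>i\<in>UNIV. c i) = 0\<close>.\<close>
    have "(\<Sum>i\<in>UNIV. \<Sum>j\<in>UNIV. e i j k) =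
      (\<Sum>i\<in>UNIV. \<Sum>j\<in>UNIV. c i * of_bool (k = i) * (u j * int (d j))) -
      (\<Sum>i\<in>UNIV. \<Sum>j\<in>UNIV. c i * (u j * int (d j) * of_bool (k = j)))"
      by (simp add: e_def m algebra_simps flip: sum_subtractf)
    also have "\<dots> = (\<Sum>i\<in>UNIV. c i * of_bool (k = i)) * (\<Sum>j\<in>UNIV. u j * int (d j)) -
      (\<Sum>i\<in>UNIV. c i) * (\<Sum>j\<in>UNIV. u j * int (d j) * of_bool (k = j))"
      unfolding sum_product ..
    also have "\<dots> = c k"
      by (simp add: u c(1) of_bool_def if_distrib[of "(*) _"] cong: if_cong)
    finally show ?thesis .
  qed
  ultimately show ?thesis by simp
qed

end

text \<open>Iterates the two-term Bezout identity; it supplies the weights for the Koszul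
  combination. Summing over indices allows repeated values of \<open>d\<close>.\<close>

lemma bezout_Gcd_image:
  assumes "finite A"
  shows "\<exists>u :: 'a \<Rightarrow> int. (\<Sum>i\<in>A. u i * int (d i)) = int (Gcd (d ` A))"
  using assms
proof (induction A rule: finite_induct)
  case (insert a A)
  then obtain u where u: "(\<Sum>i\<in>A. u i * int (d i)) = int (Gcd (d ` A))" by blast
  obtain s t where st: "s * int (d a) + t * int (Gcd (d ` A)) = gcd (int (d a)) (int (Gcd (d ` A)))"
    using bezout_int by blast
  have "(\<Sum>i\<in>insert a A. (if i = a then s else t * u i) * int (d i)) =
      s * int (d a) + (\<Sum>i\<in>A. t * (u i * int (d i)))"
    using insert.hyps by (auto simp: mult.assoc intro!: sum.cong)
  also have "\<dots> = int (Gcd (d ` insert a A))"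
    using st u by (simp flip: sum_distrib_left)
  finally show ?case by (intro exI)
qed simp


section \<open>The unit group of a field\<close>

lemma unit_group_pow: "x [^]\<^bsub>unit_group\<^esub> (n::nat) = x ^ n"
  by (induction n) (simp_all add: nat_pow_def unit_group_def mult.commute)

lemma unit_group_ord_dvd_iff:
  fixes x :: "'k::field"
  assumes "x \<noteq> 0"
  shows "group.ord unit_group x dvd n \<longleftrightarrow> x ^ n = 1"
  using group.pow_eq_id[OF group_unit_group, of x n] assms
  unfolding unit_group_pow by (auto simp: unit_group_def)

lemma unit_group_ord_dvd_diff:
  fixes x :: "'k::field"
  assumes x: "x \<noteq> 0" and eq: "x ^ a = x ^ b"
  shows "int (group.ord unit_group x) dvd int a - int b"
proof -
  \<comment> \<open>The smaller power is cancelled, which needs \<open>p \<le> q\<close>; the other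
    case differs only by a sign.\<close>
  have *: "int (group.ord unit_group x) dvd int q - int p" if "x ^ p = x ^ q" "p \<le> q" for p q
  proof -
    have "x ^ p * x ^ (q - p) = x ^ (p + (q - p))"
      by (rule power_add[symmetric])
    also have "\<dots> = x ^ p * 1" using that by simp
    finally have "x ^ p * x ^ (q - p) = x ^ p * 1" .
    then have "x ^ (q - p) = 1" using x by simp
    then show ?thesis
      using that(2) unit_group_ord_dvd_iff[OF x, of "q - p"]
      by (metis int_dvd_int_iff of_nat_diff)
  qed
  show ?thesis
    using *[of a b] *[of b a] eq by (metis dvd_diff_commute nat_le_linear)
qed

text \<open>In a finite group the natural powers of an element already form the subgroup it
  generates.\<close>

lemma unit_group_generator_power:
  fixes \<beta> x :: "'k::{finite,field}"
  assumes "\<beta> \<in> carrier unit_group" "generate unit_group {\<beta>} = carrier unit_group" "x \<noteq> 0"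
  shows "\<exists>k::nat. x = \<beta> ^ k"
proof -
  have "x \<in> generate unit_group {\<beta>}"
    using assms by (simp add: unit_group_def)
  also have "\<dots> = {\<beta> [^]\<^bsub>unit_group\<^esub> k | k. k \<in> (UNIV::nat set)}"
    by (rule group.generate_pow_on_finite_carrier[OF group_unit_group _ assms(1)]) simp
  finally show ?thesis by (auto simp: unit_group_pow)
qed


section \<open>The degenerate torus\<close>

lemma degenerate_torus_member:
  assumes "\<And>i. x $ i \<noteq> 0"
  shows "\<exists>P \<in> degenerate_torus v. (\<chi> i. (x $ i) ^ v i) \<in> P"
proof -
  let ?y = "\<chi> i. (x $ i) ^ v i"
  have "?y $ j \<noteq> 0" for j using assms by simp
  then have "?y \<noteq> 0" by (metis zero_index)
  then have "?y \<in> proj_rel `` {?y}"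
    by (auto simp: proj_rel_def intro!: exI[of _ 1])
  then show ?thesis
    using assms by (auto simp: degenerate_torus_def)
qed

lemma degenerate_torusE:
  assumes "P \<in> degenerate_torus v" "z \<in> P"
  obtains c x where "c \<noteq> 0" "\<And>i. x $ i \<noteq> 0" "\<And>i. z $ i = c * x $ i ^ v i"
proof -
  obtain x where x: "\<forall>i. x $ i \<noteq> 0" and P: "P = proj_rel `` {\<chi> i. (x $ i) ^ v i}"
    using assms(1) unfolding degenerate_torus_def by blast
  obtain c where "c \<noteq> 0" "z = c *s (\<chi> i. (x $ i) ^ v i)"
    using assms(2) unfolding P proj_rel_def by blast
  with x show ?thesis by (intro that[of c x]) simp_all
qed

text \<open>On the points with \<open>i\<close>-th coordinate \<open>\<beta> ^ (v i * k i)\<close> the monomials of \<open>f\<close> are characters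
  in \<open>k\<close>, so the coefficients of the monomials inducing the same character sum to \<open>0\<close>.\<close>

lemma binomial_decomposition:
  fixes f :: "('n::finite, 'k::field) mpoly"
  assumes \<beta>: "\<beta> \<noteq> 0"
    and J: "is_ideal J"
    and vanish: "\<And>k :: 'n \<Rightarrow> nat. mpoly_eval f (\<chi> i. (\<beta> ^ k i) ^ v i) = 0"
    and binom: "\<And>a b. a \<in> Poly_Mapping.keys f \<Longrightarrow> b \<in> Poly_Mapping.keys f \<Longrightarrow>
      (\<And>i. (\<beta> ^ v i) ^ Poly_Mapping.lookup a i = (\<beta> ^ v i) ^ Poly_Mapping.lookup b i) \<Longrightarrow>
      mon a - mon b \<in> J"
  shows "f \<in> J"
proof -
  define \<rho> where "\<rho> = (\<lambda>(m :: 'n \<Rightarrow>\<^sub>0 nat) k. mon_eval (\<chi> i. (\<beta> ^ k i) ^ v i) m)"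
  let ?X = "\<rho> ` Poly_Mapping.keys f"
  let ?C = "\<lambda>\<psi>. {m \<in> Poly_Mapping.keys f. \<rho> m = \<psi>}"
  \<comment> \<open>Evaluating at unit vectors recovers each coordinate, so equal characters satisfy
    the hypothesis of \<open>binom\<close>.\<close>
  have single: "\<rho> m (\<lambda>j. if j = i then 1 else 0) = (\<beta> ^ v i) ^ Poly_Mapping.lookup m i" for m i
  proof -
    have "\<rho> m (\<lambda>j. if j = i then 1 else 0) =
        (\<Prod>j\<in>UNIV. if j = i then (\<beta> ^ v j) ^ Poly_Mapping.lookup m j else 1)"
      unfolding \<rho>_def mon_eval_def by (rule prod.cong) auto
    then show ?thesis by simp
  qed
  have coeff_sum: "(\<Sum>m\<in>?C \<psi>. Poly_Mapping.lookup f m) = 0" if "\<psi> \<in> ?X" for \<psi>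
  proof (rule characters_independent[where opr = "\<lambda>k l i. k i + l i" and X = ?X and
        c = "\<lambda>\<psi>. \<Sum>m\<in>?C \<psi>. Poly_Mapping.lookup f m"])
    fix k
    have "(\<Sum>\<psi>\<in>?X. (\<Sum>m\<in>?C \<psi>. Poly_Mapping.lookup f m) * \<psi> k) =
        (\<Sum>\<psi>\<in>?X. \<Sum>m\<in>?C \<psi>. Poly_Mapping.lookup f m * \<rho> m k)"
      unfolding sum_distrib_right by (intro sum.cong) auto
    also have "\<dots> = (\<Sum>m\<in>Poly_Mapping.keys f. Poly_Mapping.lookup f m * \<rho> m k)"
      by (rule sum.image_gen[symmetric]) simp
    also have "\<dots> = 0"
      using vanish[of k] by (simp add: mpoly_eval_def \<rho>_def mon_eval_def)
    finally show "(\<Sum>\<psi>\<in>?X. (\<Sum>m\<in>?C \<psi>. Poly_Mapping.lookup f m) * \<psi> k) = 0" .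
  next
    fix \<psi> k l assume "\<psi> \<in> ?X"
    then show "\<psi> (\<lambda>i. k i + l i) = \<psi> k * \<psi> l"
      by (auto simp: \<rho>_def mon_eval_def power_add power_mult_distrib prod.distrib)
  next
    fix \<psi> assume "\<psi> \<in> ?X"
    then have "\<psi> (\<lambda>_. 0) = 1" by (auto simp: \<rho>_def mon_eval_def)
    then show "\<exists>k. \<psi> k \<noteq> 0" by (metis one_neq_zero)
  qed (use that in auto)
  have "(\<Sum>m\<in>?C \<psi>. Poly_Mapping.single m (Poly_Mapping.lookup f m)) \<in> J" if "\<psi> \<in> ?X" for \<psi>
  proof -
    \<comment> \<open>One reference monomial per class: replacing each \<open>mon m\<close> by
      \<open>mon r\<close> changes the class sum by an element of \<open>J\<close>.\<close>
    from that obtain r where r: "r \<in> ?C \<psi>" by auto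
    have "mon m - mon r \<in> J" if "m \<in> ?C \<psi>" for m
    proof (rule binom)
      fix i
      from that r have "\<rho> m = \<rho> r" by simp
      then show "(\<beta> ^ v i) ^ Poly_Mapping.lookup m i = (\<beta> ^ v i) ^ Poly_Mapping.lookup r i"
        by (metis single)
    qed (use that r in auto)
    \<comment> \<open>Here \<open>Poly_Mapping.single 0\<close> embeds constants. The multiple of
      \<open>mon r\<close> split off below vanishes by \<open>coeff_sum\<close>.\<close>
    then have "(\<Sum>m\<in>?C \<psi>. Poly_Mapping.single 0 (Poly_Mapping.lookup f m) * (mon m - mon r)) \<in> J"
      by (intro is_ideal_sum[OF J] is_ideal_scale[OF J])
    also have "(\<Sum>m\<in>?C \<psi>. Poly_Mapping.single 0 (Poly_Mapping.lookup f m) * (mon m - mon r)) =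
        (\<Sum>m\<in>?C \<psi>. Poly_Mapping.single m (Poly_Mapping.lookup f m)) -
        (\<Sum>m\<in>?C \<psi>. Poly_Mapping.single 0 (Poly_Mapping.lookup f m)) * mon r"
      by (simp add: right_diff_distrib mult_single sum_subtractf sum_distrib_right)
    also have "(\<Sum>m\<in>?C \<psi>. Poly_Mapping.single 0 (Poly_Mapping.lookup f m)) =
        Poly_Mapping.single (0 :: 'n \<Rightarrow>\<^sub>0 nat) (\<Sum>m\<in>?C \<psi>. Poly_Mapping.lookup f m)"
      by (rule poly_mapping_eqI) (simp add: lookup_sum lookup_single when_def)
    finally show ?thesis using coeff_sum[OF that] by simp
  qed
  then have "(\<Sum>\<psi>\<in>?X. \<Sum>m\<in>?C \<psi>. Poly_Mapping.single m (Poly_Mapping.lookup f m)) \<in> J"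
    by (rule is_ideal_sum[OF J])
  also have "(\<Sum>\<psi>\<in>?X. \<Sum>m\<in>?C \<psi>. Poly_Mapping.single m (Poly_Mapping.lookup f m)) =
      (\<Sum>m\<in>Poly_Mapping.keys f. Poly_Mapping.single m (Poly_Mapping.lookup f m))"
    by (rule sum.image_gen[symmetric]) simp
  finally show ?thesis by (simp flip: poly_mapping_sum_single)
qed

section \<open>The two inclusions between the vanishing ideal and the saturation\<close>

theorem proposition3p18:
  fixes v d :: "'n::{finite,linorder} \<Rightarrow> nat"
    and \<beta> :: "'k::{finite,field}"
    and I' :: "('n, 'k) mpoly set"
  assumes "\<And>i. v i > 0"
    and "\<beta> \<in> carrier unit_group"
    and "generate unit_group {\<beta>} = carrier unit_group"
    and "\<And>i. d i = group.ord unit_group (\<beta> ^ v i)"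
    and "I' = ideal_gen {tvar i ^ lcm (d i) (d j) - tvar j ^ lcm (d i) (d j) | i j. i < j}"
    and "Gcd (range d) = 1"
  shows "vanishing_ideal (degenerate_torus v) = saturation I' (\<Prod>i\<in>UNIV. tvar i)"
proof
  let ?h = "\<Prod>i\<in>UNIV. tvar i :: ('n, 'k) mpoly"
  let ?J = "saturation I' ?h"
  have \<beta>: "\<beta> \<noteq> 0" using assms(2) by (simp add: unit_group_def)
  have I': "is_ideal I'" unfolding assms(5) by (rule is_ideal_ideal_gen)
  note J = is_ideal_saturation[OF I', of ?h]
  note cancel = saturation_cancel_mon[OF I']

  show "?J \<subseteq> vanishing_ideal (degenerate_torus v)"
  proof
    fix f assume "f \<in> ?J"
    then obtain N where N: "f * ?h ^ N \<in> I'" unfolding saturation_def by blast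
    show "f \<in> vanishing_ideal (degenerate_torus v)"
    proof (rule vanishing_idealI)
      fix P :: "('k, 'n) vec set" and z
      assume "P \<in> degenerate_torus v" "z \<in> P"
      then obtain c x where z: "c \<noteq> 0" "\<And>i. x $ i \<noteq> 0" "\<And>i. z $ i = c * x $ i ^ v i"
        by (rule degenerate_torusE) blast
      \<comment> \<open>The order \<open>d i\<close> of \<open>\<beta> ^ v i\<close> divides
        \<open>l\<close>, so only the common scalar \<open>c\<close> survives. As this is
        independent of \<open>i\<close>, the generators of \<open>I'\<close> vanish on the whole
        line through \<open>z\<close>.\<close>
      have pow: "z $ i ^ l = c ^ l" if "d i dvd l" for i l
      proof -
        obtain k where "x $ i = \<beta> ^ k"
          using unit_group_generator_power[OF assms(2,3) z(2)] by blast
        moreover have "(\<beta> ^ v i) ^ l = 1"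
          using that unit_group_ord_dvd_iff[of "\<beta> ^ v i" l] \<beta> by (simp add: assms(4))
        ultimately have "(x $ i ^ v i) ^ l = 1"
          by (metis power_mult mult.commute power_one)
        then show ?thesis by (simp add: z(3) power_mult_distrib)
      qed
      have "I' \<subseteq> {f. line_eval z f = 0}"
        unfolding assms(5)
        by (intro ideal_gen_minimal is_ideal_line_eval_kernel)
          (auto simp: line_eval_diff line_eval_tvar_power pow)
      \<comment> \<open>Polynomials over a field form a domain, so the nonzero factor from
        \<open>?h ^ N\<close> can be cancelled.\<close>
      with N have "line_eval z f * line_eval z (?h ^ N) = 0"
        by (auto simp flip: line_eval_mult)
      moreover have "line_eval z (?h ^ N) \<noteq> 0"
        by (rule line_eval_prod_tvar_power_nonzero) (simp add: z)
      ultimately show "line_eval z f = 0" by simp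
    qed
  qed

  have gens: "(\<lambda>k. int (lcm (d i) (d j)) * (of_bool (k = i) - of_bool (k = j)))
      \<in> binomial_lattice ?J" if "i \<noteq> j" for i j
  proof -
    let ?l = "lcm (d i) (d j)"
    have "tvar i ^ ?l - tvar j ^ ?l \<in> I'"
    proof (cases "i < j")
      case True
      then show ?thesis unfolding assms(5) by (intro ideal_gen_base) blast
    next
      case False
      \<comment> \<open>The generators are listed only for increasing indices; the other order is a
        negative.\<close>
      with that have "j < i" by simp
      then have "tvar j ^ ?l - tvar i ^ ?l \<in> I'"
        unfolding assms(5) lcm.commute[of "d i"] by (intro ideal_gen_base) blast
      from is_ideal_neg[OF I' this] show ?thesis by simp
    qed
    then have "tvar i ^ ?l - tvar j ^ ?l \<in> ?J"
      using subset_saturation[OF I'] by blast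
    with that show ?thesis by (intro binomial_lattice_tvar[OF J]) (erule cancel)
  qed
  obtain u where u: "(\<Sum>i\<in>UNIV. u i * int (d i)) = 1"
    using bezout_Gcd_image[of UNIV d] assms(6) by auto

  show "vanishing_ideal (degenerate_torus v) \<subseteq> ?J"
    unfolding vanishing_ideal_def
  proof (rule ideal_gen_minimal[OF _ J], clarify)
    fix f :: "('n, 'k) mpoly"
    assume hom: "homogeneous f" and van: "\<forall>P\<in>degenerate_torus v. vanishes_at f P"
    show "f \<in> ?J"
    proof (rule binomial_decomposition[OF \<beta> J])
      fix k :: "'n \<Rightarrow> nat"
      show "mpoly_eval f (\<chi> i. (\<beta> ^ k i) ^ v i) = 0"
        using degenerate_torus_member[of "\<chi> i. \<beta> ^ k i" v] \<beta> van
        by (auto simp: vanishes_at_def)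
    next
      fix a b
      assume ab: "a \<in> Poly_Mapping.keys f" "b \<in> Poly_Mapping.keys f"
        and eq: "\<And>i. (\<beta> ^ v i) ^ Poly_Mapping.lookup a i = (\<beta> ^ v i) ^ Poly_Mapping.lookup b i"
      define c where "c = (\<lambda>i. int (Poly_Mapping.lookup a i) - int (Poly_Mapping.lookup b i))"
      \<comment> \<open>Homogeneity makes the coordinates of \<open>c\<close> sum to zero, the
        syzygy condition; equality of characters gives the divisibility by
        \<open>d i\<close>.\<close>
      have "mon_degree a = mon_degree b"
        using hom ab unfolding homogeneous_def mon_degree_def by metis
      then have "(\<Sum>i\<in>UNIV. c i) = 0"
        by (simp add: c_def sum_subtractf mon_degree_def flip: of_nat_sum)
      moreover have "int (d i) dvd c i" for i
        using unit_group_ord_dvd_diff[OF _ eq] \<beta> by (simp add: c_def assms(4))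
      ultimately have "c \<in> binomial_lattice ?J"
        by (intro syzygy_in_binomial_lattice[OF J _ gens u]) (erule cancel)
      then show "mon a - mon b \<in> ?J"
        by (rule binomial_latticeD) (simp add: c_def)
    qed
  qed
qed

end
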